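(* Let $(X,\sigma_X)$ be a subshift and $\mathcal F=\{\log f_n\}_{n=1}^\infty$ a sequence on $X$ with bounded variation satisfying conditions (C1) and (C2) (defined in the context). Let $m$ be the unique invariant Gibbs measure for $\mathcal F$. Then the following statements are equivalent. (i) There exists $h\in C(X)$ such that $\lim_{n\to\infty}\frac1n\log\left(\frac{f_n(x)}{e^{(S_nh)(x)}}\right)=0$ for every $x\in X$. (ii) $\mathcal F$ is asymptotically additive on $X$. (iii) The measure $m$ is an invariant weak Gibbs measure for a continuous function on $X$.
   Context: $\mathbb N=\{1,2,\dots\}$. A (one-sided) subshift $(X,\sigma_X)$ is a closed set $X\subseteq\{1,\dots,k\}^{\mathbb N}$ (some $k\ge1$) with $\sigma_X(X)\subseteq X$, where $(\sigma_Xx)_i=x_{i+1}$. $B_n(X)$ is the set of words of length $n$ appearing in points of $X$; $B_0(X)=\{\epsilon\}$ (empty word). The cylinder $[x_1\dots x_n]$ is the set of $z\in X$ with $z_i=x_i$ for $1\le i\le n$. $M(X,\sigma_X)$ is the set of $\sigma_X$-invariant Borel probability measures. $(S_nh)(x)=\sum_{i=0}^{n-1}h(\sigma_X^ix)$. A sequence $\mathcal F=\{\log f_n\}_{n=1}^\infty$ on $X$ consists of continuous $f_n:X\to(0,\infty)$. It is subadditive if $f_{n+m}(x)\le f_n(x)f_m(\sigma_X^nx)$ for all $n,m\in\mathbb N$, $x\in X$. It has bounded variation if $\sup_{n\in\mathbb N}\sup\{f_n(x)/f_n(y):x,y\in X,\ x_i=y_i\text{ for }1\le i\le n\}<\infty$.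 It is asymptotically additive if for every $\epsilon>0$ there is a continuous function $\rho_\epsilon$ on $X$ with $\limsup_{n\to\infty}\frac1n\lVert\log f_n-S_n\rho_\epsilon\rVert_\infty<\epsilon$ (supremum norm). (C1): $\{\log(e^Cf_n)\}_{n=1}^\infty$ is subadditive for some $C\ge0$. (C2): there exist $p\in\mathbb N$ and $D>0$ such that for any $u\in B_n(X)$, $v\in B_m(X)$, $n,m\in\mathbb N$, there exist $0\le k\le p$ and $w\in B_k(X)$ (with $uwv$ an allowable word) such that $\sup\{f_{n+m+k}(x):x\in[uwv]\}\ge D\sup\{f_n(x):x\in[u]\}\sup\{f_m(x):x\in[v]\}$. Pressure: $P(\mathcal F)=\limsup_{n\to\infty}\frac1n\log\sum_{u\in B_n(X)}\sup\{f_n(x):x\in[u]\}$. When $P(\mathcal F)\ne-\infty$, $\mu\in M(X,\sigma_X)$ is a weak Gibbs measure for $\mathcal F$ if there are $C_n>0$ with $\lim_{n\to\infty}\frac1n\log C_n=0$ and $\frac1{C_n}<\frac{\mu[x_1\dots x_n]}{e^{-nP(\mathcal F)}f_n(x)}<C_n$ for every $x\in X$, $n\in\mathbb N$; it is a Gibbs measure if $C_n$ can be taken independent of $n$. For a continuous function $h$, these notions refer to the sequence with $f_n=e^{S_nh}$. It is known (Feng) that a sequence with bounded variation satisfying (C1) and (C2) has a unique invariant Gibbs measure. *)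

theory Defs
  imports "HOL-Probability.Probability"
begin

text \<open>
  Points are functions \<open>nat \<Rightarrow> nat\<close> with the product topology (each factor discrete).  Coordinates
  are indexed from 0, so \<open>x i\<close> is the coordinate usually written \<open>x\<^sub>i\<^sub>+\<^sub>1\<close>.  A sequence
  \<open>(log f\<^sub>n)\<close>, \<open>n \<ge> 1\<close>, is represented by \<open>f :: nat \<Rightarrow> (nat \<Rightarrow> nat) \<Rightarrow> real\<close>; the value \<open>f 0\<close> and
  the values of \<open>f n\<close> outside the subshift are irrelevant.
\<close>

definition shift_map :: "(nat \<Rightarrow> nat) \<Rightarrow> (nat \<Rightarrow> nat)" where
  "shift_map x = (\<lambda>i. x (i + 1))"

definition subshift :: "(nat \<Rightarrow> nat) set \<Rightarrow> bool" where
  "subshift X \<longleftrightarrow>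
     (\<exists>k\<ge>1. \<forall>x\<in>X. \<forall>i. x i \<in> {1..k}) \<and> closed X \<and> shift_map ` X \<subseteq> X"

definition words :: "(nat \<Rightarrow> nat) set \<Rightarrow> nat \<Rightarrow> nat list set" where
  "words X n = {map x [i..<i + n] | x i. x \<in> X}"

definition cylinder :: "(nat \<Rightarrow> nat) set \<Rightarrow> nat list \<Rightarrow> (nat \<Rightarrow> nat) set" where
  "cylinder X u = {z \<in> X. \<forall>i<length u. z i = u ! i}"

definition birkhoff_sum :: "nat \<Rightarrow> ((nat \<Rightarrow> nat) \<Rightarrow> real) \<Rightarrow> (nat \<Rightarrow> nat) \<Rightarrow> real" where
  "birkhoff_sum n h x = (\<Sum>i<n. h ((shift_map ^^ i) x))"

definition log_sequence :: "(nat \<Rightarrow> nat) set \<Rightarrow> (nat \<Rightarrow> (nat \<Rightarrow> nat) \<Rightarrow> real) \<Rightarrow> bool" where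
  "log_sequence X f \<longleftrightarrow> (\<forall>n\<ge>1. continuous_on X (f n) \<and> (\<forall>x\<in>X. f n x > 0))"

definition subadditive :: "(nat \<Rightarrow> nat) set \<Rightarrow> (nat \<Rightarrow> (nat \<Rightarrow> nat) \<Rightarrow> real) \<Rightarrow> bool" where
  "subadditive X f \<longleftrightarrow>
     (\<forall>n\<ge>1. \<forall>m\<ge>1. \<forall>x\<in>X. f (n + m) x \<le> f n x * f m ((shift_map ^^ n) x))"

definition bounded_variation_seq ::
    "(nat \<Rightarrow> nat) set \<Rightarrow> (nat \<Rightarrow> (nat \<Rightarrow> nat) \<Rightarrow> real) \<Rightarrow> bool" where
  "bounded_variation_seq X f \<longleftrightarrow>
     bdd_above {f n x / f n y | n x y. n \<ge> 1 \<and> x \<in> X \<and> y \<in> X \<and> (\<forall>i<n. x i = y i)}"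

definition asymptotically_additive ::
    "(nat \<Rightarrow> nat) set \<Rightarrow> (nat \<Rightarrow> (nat \<Rightarrow> nat) \<Rightarrow> real) \<Rightarrow> bool" where
  "asymptotically_additive X f \<longleftrightarrow>
     (\<forall>\<epsilon>>0. \<exists>\<rho>. continuous_on X \<rho> \<and>
        limsup (\<lambda>n. ereal (1 / real n * (SUP x\<in>X. \<bar>ln (f n x) - birkhoff_sum n \<rho> x\<bar>))) < ereal \<epsilon>)"

definition condition_C1 :: "(nat \<Rightarrow> nat) set \<Rightarrow> (nat \<Rightarrow> (nat \<Rightarrow> nat) \<Rightarrow> real) \<Rightarrow> bool" where
  "condition_C1 X f \<longleftrightarrow> (\<exists>C\<ge>0. subadditive X (\<lambda>n x. exp C * f n x))"

definition cylinder_sup ::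
    "(nat \<Rightarrow> nat) set \<Rightarrow> (nat \<Rightarrow> (nat \<Rightarrow> nat) \<Rightarrow> real) \<Rightarrow> nat list \<Rightarrow> real" where
  "cylinder_sup X f u = (SUP x\<in>cylinder X u. f (length u) x)"

definition condition_C2 :: "(nat \<Rightarrow> nat) set \<Rightarrow> (nat \<Rightarrow> (nat \<Rightarrow> nat) \<Rightarrow> real) \<Rightarrow> bool" where
  "condition_C2 X f \<longleftrightarrow>
     (\<exists>p\<ge>1. \<exists>D>0. \<forall>n\<ge>1. \<forall>m\<ge>1. \<forall>u\<in>words X n. \<forall>v\<in>words X m.
        \<exists>k\<le>p. \<exists>w\<in>words X k. u @ w @ v \<in> words X (n + k + m) \<and>
          cylinder_sup X f (u @ w @ v) \<ge> D * cylinder_sup X f u * cylinder_sup X f v)"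

text \<open>For nonempty \<open>X\<close> and \<open>f > 0\<close> the argument of \<open>ln\<close> is positive.\<close>

definition pressure :: "(nat \<Rightarrow> nat) set \<Rightarrow> (nat \<Rightarrow> (nat \<Rightarrow> nat) \<Rightarrow> real) \<Rightarrow> ereal" where
  "pressure X f = limsup (\<lambda>n. ereal (1 / real n * ln (\<Sum>u\<in>words X n. cylinder_sup X f u)))"

definition invariant_measures :: "(nat \<Rightarrow> nat) set \<Rightarrow> (nat \<Rightarrow> nat) measure set" where
  "invariant_measures X =
     {\<mu>. prob_space \<mu> \<and> sets \<mu> = sets (restrict_space borel X) \<and>
        (\<forall>A\<in>sets \<mu>. emeasure \<mu> (shift_map -` A \<inter> X) = emeasure \<mu> A)}"

definition gibbs_bounds ::
    "(nat \<Rightarrow> nat) set \<Rightarrow> (nat \<Rightarrow> (nat \<Rightarrow> nat) \<Rightarrow> real) \<Rightarrow> (nat \<Rightarrow> nat) measure \<Rightarrow> real \<Rightarrow>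
      (nat \<Rightarrow> real) \<Rightarrow> bool" where
  "gibbs_bounds X f \<mu> P C \<longleftrightarrow>
     (\<forall>x\<in>X. \<forall>n\<ge>1.
        1 / C n < measure \<mu> (cylinder X (map x [0..<n])) / (exp (- real n * P) * f n x) \<and>
        measure \<mu> (cylinder X (map x [0..<n])) / (exp (- real n * P) * f n x) < C n)"

text \<open>Finiteness of the pressure is part of being a (weak) Gibbs measure.\<close>

definition weak_gibbs_measure ::
    "(nat \<Rightarrow> nat) set \<Rightarrow> (nat \<Rightarrow> (nat \<Rightarrow> nat) \<Rightarrow> real) \<Rightarrow> (nat \<Rightarrow> nat) measure \<Rightarrow> bool" where
  "weak_gibbs_measure X f \<mu> \<longleftrightarrow>
     \<mu> \<in> invariant_measures X \<and>
     (\<exists>P C. pressure X f = ereal P \<and> (\<forall>n\<ge>1. C n > 0) \<and>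
        (\<lambda>n. 1 / real n * ln (C n)) \<longlonglongrightarrow> 0 \<and> gibbs_bounds X f \<mu> P C)"

definition gibbs_measure ::
    "(nat \<Rightarrow> nat) set \<Rightarrow> (nat \<Rightarrow> (nat \<Rightarrow> nat) \<Rightarrow> real) \<Rightarrow> (nat \<Rightarrow> nat) measure \<Rightarrow> bool" where
  "gibbs_measure X f \<mu> \<longleftrightarrow>
     \<mu> \<in> invariant_measures X \<and>
     (\<exists>P C. pressure X f = ereal P \<and> C > 0 \<and> gibbs_bounds X f \<mu> P (\<lambda>_. C))"

end

theory Submission
  imports Defs
begin

text \<open>
  All three conditions amount to \<open>1/n \<bar>log f\<^sub>n - S\<^sub>n h\<bar> \<rightarrow> 0\<close> uniformly on \<open>X\<close> for a single continuous
  \<open>h\<close>.  Pointwise convergence as in (i) is automatically uniform: from above by compactness and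
  subadditivity, from below because (C2) allows gluing bad cylinders into one bad point.  An
  asymptotically additive sequence has such an \<open>h\<close> by an argument of Cuneo.  Finally, the Gibbs
  property of \<open>m\<close> turns a weak Gibbs bound for \<open>h\<close> into a uniform estimate for
  \<open>log f\<^sub>n - S\<^sub>n (h + c)\<close>, with \<open>c\<close> the difference of the pressures, and conversely.
\<close>

text \<open>The upper and the lower half of uniformity for
  \<open>g n x = ln (f n x) - birkhoff_sum n h x\<close> are of different nature. By (C1) upper
  bounds propagate along the blocks of an orbit, but nothing propagates lower bounds: very negative
  values could occur at a different point for each \<open>n\<close> without violating pointwise
  convergence. The obstacle is to collect infinitely many of them on one orbit. Bounded variation
  and uniform continuity of \<open>h\<close> make badness a property of a whole cylinder, up to
  o(n), and subadditivity lets a bad block pull down the value of every longer word ending in it.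
  Estimates have the form \<open>\<epsilon> * real n + K\<close> for all \<open>n \<ge> 1\<close>,
  since the failure of such a lower bound yields blocks that beat any constant \<open>K\<close>, and
  \<open>K\<close> may be chosen after the prefix that has to be outweighed.\<close>

section \<open>Topology of shift spaces\<close>

lemma shift_map_funpow: "(shift_map ^^ n) x = (\<lambda>i. x (i + n))"
  by (induction n arbitrary: x) (auto simp: shift_map_def funpow_swap1)

lemma continuous_on_shift_map_funpow: "continuous_on X (shift_map ^^ n)"
  unfolding shift_map_funpow
  by (intro continuous_on_coordinatewise_then_product continuous_on_subset[OF continuous_on_product_coordinates]) auto

lemma subshift_compact:
  assumes "subshift X"
  shows "compact X"
proof -
  obtain k where k: "\<forall>x\<in>X. \<forall>i. x i \<in> {1..k}" and "closed X"
    using assms by (auto simp: subshift_def)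
  have "compactin (product_topology (\<lambda>_. euclidean) UNIV) (PiE UNIV (\<lambda>_::nat. {1..k}))"
    by (subst compactin_PiE) (auto simp: finite_imp_compact)
  then have "compact (PiE UNIV (\<lambda>_::nat. {1..k}))"
    by (simp add: euclidean_product_topology)
  moreover have "X = X \<inter> PiE UNIV (\<lambda>_::nat. {1..k})"
    using k by (auto simp: PiE_def)
  ultimately show ?thesis
    using \<open>closed X\<close> closed_Int_compact by metis
qed

lemma subshift_funpow_mem:
  assumes "subshift X" "x \<in> X"
  shows "(shift_map ^^ n) x \<in> X"
  using assms by (induction n) (auto simp: subshift_def)

lemma compact_continuous_bound:
  fixes h :: "'a::topological_space \<Rightarrow> real"
  assumes "compact X" "continuous_on X h"
  obtains M where "M > 0" "\<And>x. x \<in> X \<Longrightarrow> \<bar>h x\<bar> \<le> M"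
proof -
  have "bounded (h ` X)"
    by (intro compact_imp_bounded compact_continuous_image assms)
  then show ?thesis
    using that by (auto simp: bounded_pos)
qed

text \<open>Coordinates are discrete, so eventual equality in each coordinate is convergence in the
  product, and \<open>X\<close> is closed. In this form a point glued from infinitely many pieces is
  shown to lie in \<open>X\<close>.\<close>

lemma subshift_limit_mem:
  assumes "subshift X" "\<And>j. z j \<in> X" "\<And>i. \<forall>\<^sub>F j in sequentially. z j i = x i"
  shows "x \<in> X"
proof -
  have "closed X"
    using assms by (simp add: subshift_def)
  moreover have "z \<longlonglongrightarrow> x"
  proof -
    have "limitin (product_topology (\<lambda>_. euclidean) UNIV) z x sequentially"
      unfolding limitin_componentwise using assms(3)
      by (auto intro: tendsto_eventually)
    then show ?thesis
      by (simp add: euclidean_product_topology)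
  qed
  ultimately show ?thesis
    using assms(2) closed_sequentially by blast
qed

lemma open_agree: "open {y :: nat \<Rightarrow> 'a::discrete_topology. \<forall>i<n. y i = x i}"
proof -
  have "open (\<Inter>i\<in>{..<n}. (\<lambda>y :: nat \<Rightarrow> 'a. y i) -` {x i})"
    by (intro open_INT open_vimage ballI continuous_on_product_coordinates finite_lessThan)
       (rule discrete_topology_class.open_discrete)
  also have "(\<Inter>i\<in>{..<n}. (\<lambda>y :: nat \<Rightarrow> 'a. y i) -` {x i}) = {y. \<forall>i<n. y i = x i}"
    by auto
  finally show ?thesis .
qed

text \<open>A basic open set of the product constrains finitely many coordinates, all below some
  \<open>n\<close>; so cylinders form a neighbourhood base and can replace a metric.\<close>

lemma open_contains_agree:
  fixes x :: "nat \<Rightarrow> 'a::discrete_topology"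
  assumes "open U" "x \<in> U"
  obtains n where "\<And>y. (\<forall>i<n. y i = x i) \<Longrightarrow> y \<in> U"
proof -
  have "openin (product_topology (\<lambda>_. euclidean) UNIV) U"
    using \<open>open U\<close> by (simp add: euclidean_product_topology)
  then obtain V where V: "x \<in> (\<Pi>\<^sub>E i\<in>UNIV. V i)" "finite {i. V i \<noteq> (UNIV :: 'a set)}"
      "(\<Pi>\<^sub>E i\<in>UNIV. V i) \<subseteq> U"
    using product_topology_open_contains_basis[of "\<lambda>_. euclidean" UNIV U x] \<open>x \<in> U\<close> by auto
  obtain n where n: "\<And>i. V i \<noteq> UNIV \<Longrightarrow> i < n"
    using V(2) finite_nat_set_iff_bounded by auto
  have "y \<in> U" if "\<forall>i<n. y i = x i" for y
  proof -
    have "y i \<in> V i" for i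
      using n[of i] V(1) that by (cases "V i = UNIV") (auto simp: PiE_iff)
    then show ?thesis
      using V(3) by (auto simp: PiE_iff)
  qed
  then show ?thesis
    using that by blast
qed

text \<open>Heine-Cantor with cylinders for balls: finitely many cylinders on which \<open>h\<close>
  stays within \<epsilon>/2 of its value at the centre cover \<open>X\<close>, and agreement up to
  the longest of their lengths puts two points into a common one.\<close>

lemma continuous_on_cylinder_oscillation:
  fixes h :: "(nat \<Rightarrow> nat) \<Rightarrow> real"
  assumes "compact X" "continuous_on X h" "\<epsilon> > 0"
  shows "\<exists>N. \<forall>x\<in>X. \<forall>y\<in>X. (\<forall>i<N. x i = y i) \<longrightarrow> \<bar>h x - h y\<bar> < \<epsilon>"
proof -
  have "\<forall>x\<in>X. \<exists>n. \<forall>y\<in>X. (\<forall>i<n. y i = x i) \<longrightarrow> \<bar>h y - h x\<bar> < \<epsilon> / 2"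
  proof
    fix x assume "x \<in> X"
    then obtain U where "open U" "x \<in> U" "\<forall>y\<in>X. y \<in> U \<longrightarrow> h y \<in> ball (h x) (\<epsilon> / 2)"
      using \<open>continuous_on X h\<close> \<open>\<epsilon> > 0\<close> unfolding continuous_on_topological
      by (metis centre_in_ball half_gt_zero open_ball)
    moreover obtain n where "\<And>y. (\<forall>i<n. y i = x i) \<Longrightarrow> y \<in> U"
      using open_contains_agree[OF \<open>open U\<close> \<open>x \<in> U\<close>] by blast
    ultimately have "\<forall>y\<in>X. (\<forall>i<n. y i = x i) \<longrightarrow> \<bar>h y - h x\<bar> < \<epsilon> / 2"
      by (simp add: dist_real_def abs_minus_commute)
    then show "\<exists>n. \<forall>y\<in>X. (\<forall>i<n. y i = x i) \<longrightarrow> \<bar>h y - h x\<bar> < \<epsilon> / 2" ..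
  qed
  then obtain n where n: "\<And>x y. x \<in> X \<Longrightarrow> y \<in> X \<Longrightarrow> (\<forall>i<n x. y i = x i) \<Longrightarrow> \<bar>h y - h x\<bar> < \<epsilon> / 2"
    by metis
  have "X \<subseteq> (\<Union>x\<in>X. {y. \<forall>i<n x. y i = x i})"
    by auto
  then obtain D where D: "D \<subseteq> X" "finite D" "X \<subseteq> (\<Union>x\<in>D. {y. \<forall>i<n x. y i = x i})"
    using compactE_image[OF \<open>compact X\<close>, of X "\<lambda>x. {y. \<forall>i<n x. y i = x i}"] open_agree by blast
  \<comment> \<open>For empty \<open>X\<close> this \<open>Max\<close> is unspecified, which is
    harmless: it is compared only with \<open>n z\<close> for \<open>z \<in> D\<close>.\<close>
  define N where "N = Max (n ` D)"
  have "\<bar>h x - h y\<bar> < \<epsilon>" if "x \<in> X" "y \<in> X" "\<forall>i<N. x i = y i" for x y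
  proof -
    obtain z where z: "z \<in> D" "\<forall>i<n z. x i = z i"
      using D(3) \<open>x \<in> X\<close> by auto
    have "n z \<le> N"
      using z(1) D(2) by (simp add: N_def)
    then have "\<forall>i<n z. y i = z i"
      using z(2) that(3) by auto
    then have "\<bar>h x - h z\<bar> < \<epsilon> / 2" "\<bar>h y - h z\<bar> < \<epsilon> / 2"
      using n z D(1) that by auto
    then show ?thesis
      by linarith
  qed
  then show ?thesis
    by blast
qed

section \<open>Birkhoff sums\<close>

lemma birkhoff_sum_continuous:
  assumes "subshift X" "continuous_on X h"
  shows "continuous_on X (birkhoff_sum n h)"
  unfolding birkhoff_sum_def
  by (intro continuous_on_sum continuous_on_compose2[OF assms(2)] continuous_on_shift_map_funpow)
     (auto intro: subshift_funpow_mem assms)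

lemma birkhoff_sum_add:
  "birkhoff_sum (n + m) h x = birkhoff_sum n h x + birkhoff_sum m h ((shift_map ^^ n) x)"
proof -
  have "birkhoff_sum (n + m) h x = birkhoff_sum n h x + (\<Sum>i<m. h ((shift_map ^^ (n + i)) x))"
    by (induction m) (auto simp: birkhoff_sum_def)
  then show ?thesis
    by (simp add: birkhoff_sum_def shift_map_funpow add_ac)
qed

lemma birkhoff_sum_bound:
  assumes "subshift X" "x \<in> X" "\<And>y. y \<in> X \<Longrightarrow> \<bar>h y\<bar> \<le> M"
  shows "\<bar>birkhoff_sum n h x\<bar> \<le> real n * M"
proof -
  have "\<bar>birkhoff_sum n h x\<bar> \<le> (\<Sum>i<n. M)"
    unfolding birkhoff_sum_def
    by (intro order_trans[OF sum_abs] sum_mono assms(3) subshift_funpow_mem assms(1,2))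
  then show ?thesis
    by simp
qed

text \<open>Agreement on \<open>n\<close> coordinates leaves agreement on \<open>n - i\<close> after
  \<open>i\<close> shifts. As long as this is at least \<open>N\<close>, the terms differ by less
  than \<epsilon>; each of the at most \<open>N\<close> last terms costs at most
  \<open>2 * M\<close>.\<close>

lemma birkhoff_sum_variation:
  assumes X: "subshift X" and h: "continuous_on X h" and "\<epsilon> > 0"
  shows "\<exists>K. \<forall>n. \<forall>x\<in>X. \<forall>y\<in>X. (\<forall>i<n. x i = y i) \<longrightarrow>
           \<bar>birkhoff_sum n h x - birkhoff_sum n h y\<bar> \<le> \<epsilon> * real n + K"
proof -
  obtain N where N: "\<And>x y. x \<in> X \<Longrightarrow> y \<in> X \<Longrightarrow> (\<forall>i<N. x i = y i) \<Longrightarrow> \<bar>h x - h y\<bar> < \<epsilon>"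
    using continuous_on_cylinder_oscillation[OF subshift_compact[OF X] h \<open>\<epsilon> > 0\<close>] by blast
  obtain M where M: "M > 0" "\<And>x. x \<in> X \<Longrightarrow> \<bar>h x\<bar> \<le> M"
    using compact_continuous_bound[OF subshift_compact[OF X] h] by blast
  have "\<bar>birkhoff_sum n h x - birkhoff_sum n h y\<bar> \<le> \<epsilon> * real n + 2 * M * real N"
    if xy: "x \<in> X" "y \<in> X" "\<forall>i<n. x i = y i" for n x y
  proof -
    \<comment> \<open>\<open>n - N\<close> is truncated, so for \<open>n < N\<close> every term is
      charged \<open>2 * M\<close>.\<close>
    have term_le: "\<bar>h ((shift_map ^^ i) x) - h ((shift_map ^^ i) y)\<bar>
        \<le> \<epsilon> + (if i \<in> {n - N..<n} then 2 * M else 0)" if "i < n" for i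
    proof (cases "n < i + N")
      case True
      have "\<bar>h ((shift_map ^^ i) x)\<bar> \<le> M" "\<bar>h ((shift_map ^^ i) y)\<bar> \<le> M"
        using M subshift_funpow_mem[OF X] xy by auto
      then show ?thesis
        using True that \<open>\<epsilon> > 0\<close> by auto
    next
      case False
      have "\<forall>j<N. (shift_map ^^ i) x j = (shift_map ^^ i) y j"
        using False xy by (auto simp: shift_map_funpow)
      then show ?thesis
        using N[of "(shift_map ^^ i) x" "(shift_map ^^ i) y"] subshift_funpow_mem[OF X] xy M(1)
        by (smt (verit))
    qed
    have "\<bar>birkhoff_sum n h x - birkhoff_sum n h y\<bar>
        \<le> (\<Sum>i<n. \<epsilon> + (if i \<in> {n - N..<n} then 2 * M else 0))"
      unfolding birkhoff_sum_def sum_subtractf[symmetric]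
      by (intro order_trans[OF sum_abs] sum_mono term_le) auto
    also have "\<dots> = \<epsilon> * real n + (\<Sum>i\<in>{..<n} \<inter> {n - N..<n}. 2 * M)"
      unfolding sum.distrib by (subst sum.inter_restrict) auto
    also have "{..<n} \<inter> {n - N..<n} = {n - N..<n}"
      by auto
    also have "\<epsilon> * real n + (\<Sum>i\<in>{n - N..<n}. 2 * M) \<le> \<epsilon> * real n + 2 * M * real N"
      using M(1) by (simp add: mult.commute)
    finally show ?thesis .
  qed
  then show ?thesis
    by blast
qed

section \<open>Uniform bounds for almost subadditive sequences\<close>

text \<open>Every orbit can be cut into blocks of bounded length \<open>j\<close> on which
  \<open>g j\<close> plus \<open>C\<close> stays below \<open>\<epsilon> * real j\<close>: pointwise
  convergence yields such a block at each point, and compactness bounds its length by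
  \<open>N\<close>. \<open>K\<close> pays for the last piece.\<close>

lemma subadditive_uniform_upper_bound:
  fixes g :: "nat \<Rightarrow> 'a::topological_space \<Rightarrow> real"
  assumes "compact X"
    and T: "\<And>n x. x \<in> X \<Longrightarrow> (T ^^ n) x \<in> X"
    and cont: "\<And>n. n \<ge> 1 \<Longrightarrow> continuous_on X (g n)"
    and sub: "\<And>n k x. n \<ge> 1 \<Longrightarrow> k \<ge> 1 \<Longrightarrow> x \<in> X \<Longrightarrow> g (n + k) x \<le> g n x + g k ((T ^^ n) x) + C"
    and lim: "\<And>x. x \<in> X \<Longrightarrow> (\<lambda>n. g n x / real n) \<longlonglongrightarrow> 0"
    and "\<epsilon> > 0"
  shows "\<exists>K. \<forall>n\<ge>1. \<forall>x\<in>X. g n x \<le> \<epsilon> * real n + K"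
proof -
  \<comment> \<open>The threshold is \<open>- C\<close> rather than 0, so that a block also pays the
    constant charged by subadditivity for splitting it off.\<close>
  define U where "U n = X \<inter> (\<lambda>x. g n x - \<epsilon> * real n) -` {..< - C}" for n
  have op: "openin (top_of_set X) (U n)" if "n \<ge> 1" for n
    unfolding U_def by (intro continuous_openin_preimage_gen continuous_intros cont that)
  have cover: "\<exists>n\<ge>1. x \<in> U n" if "x \<in> X" for x
  proof -
    have "(\<lambda>n. g n x / real n + C / real n) \<longlonglongrightarrow> 0 + 0"
      by (intro tendsto_add lim that lim_const_over_n)
    then have "\<forall>\<^sub>F n in sequentially. g n x / real n + C / real n < \<epsilon>"
      using \<open>\<epsilon> > 0\<close> by (auto dest: order_tendstoD)
    then have "\<forall>\<^sub>F n in sequentially. n \<ge> 1 \<and> g n x / real n + C / real n < \<epsilon>"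
      using eventually_ge_at_top[of 1] by eventually_elim auto
    then obtain n where "n \<ge> 1" "g n x / real n + C / real n < \<epsilon>"
      using eventually_happens by fastforce
    then show ?thesis
      using that by (intro exI[of _ n]) (auto simp: U_def field_simps)
  qed
  have "\<forall>c\<in>U ` {1..}. openin (top_of_set X) c" "X \<subseteq> \<Union>(U ` {1..})"
    using op cover by auto
  then obtain D where D: "D \<subseteq> U ` {1..}" "finite D" "X \<subseteq> \<Union>D"
    using \<open>compact X\<close> unfolding compact_eq_openin_cover by meson
  then obtain J where J: "J \<subseteq> {1..}" "finite J" "X \<subseteq> \<Union>(U ` J)"
    using finite_subset_image[OF D(2,1)] by blast
  \<comment> \<open>Inserting 1 keeps \<open>Max\<close> meaningful when \<open>J\<close> is empty,
    as it may be for empty \<open>X\<close>.\<close>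
  define N where "N = Max (insert 1 J)"
  have step: "\<exists>j\<in>{1..N}. g j x + C < \<epsilon> * real j" if x: "x \<in> X" for x
  proof -
    obtain j where "j \<in> J" "x \<in> U j"
      using J(3) x by blast
    moreover have "j \<in> {1..N}"
      using \<open>j \<in> J\<close> J(1,2) by (auto simp: N_def)
    ultimately show ?thesis
      by (auto simp: U_def intro!: bexI[of _ j])
  qed
  have "\<forall>n\<in>{1..N}. \<exists>M. \<forall>x\<in>X. \<bar>g n x\<bar> \<le> M"
  proof
    fix n assume "n \<in> {1..N}"
    then show "\<exists>M. \<forall>x\<in>X. \<bar>g n x\<bar> \<le> M"
      using compact_continuous_bound[OF \<open>compact X\<close> cont[of n]] by (metis atLeastAtMost_iff)
  qed
  then obtain M where M: "\<And>n x. n \<in> {1..N} \<Longrightarrow> x \<in> X \<Longrightarrow> \<bar>g n x\<bar> \<le> M n"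
    by metis
  define K where "K = Max (insert 0 (M ` {1..N}))"
  have K: "g n x \<le> K" if "n \<in> {1..N}" "x \<in> X" for n x
  proof -
    have "g n x \<le> M n"
      using M[OF that] by simp
    also have "M n \<le> K"
      unfolding K_def using that by (intro Max_ge) auto
    finally show ?thesis .
  qed
  have "g n x \<le> \<epsilon> * real n + K" if "n \<ge> 1" "x \<in> X" for n x
    using that
  proof (induction n arbitrary: x rule: less_induct)
    case (less n)
    show ?case
    proof (cases "n \<le> N")
      case True
      have "0 \<le> \<epsilon> * real n"
        using \<open>\<epsilon> > 0\<close> by simp
      then show ?thesis
        using K[of n x] True less.prems by simp
    next
      case False
      \<comment> \<open>The first block is split off; since \<open>j \<le> N < n\<close>, a piece of
        positive length remains for the induction hypothesis.\<close>
      obtain j where j: "j \<in> {1..N}" "g j x + C < \<epsilon> * real j"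
        using step less.prems by blast
      have "g n x \<le> g j x + g (n - j) ((T ^^ j) x) + C"
        using sub[of j "n - j" x] j False less.prems by auto
      also have "g (n - j) ((T ^^ j) x) \<le> \<epsilon> * real (n - j) + K"
        using j False less.prems T by (intro less.IH) auto
      finally show ?thesis
        using j False by (simp add: of_nat_diff algebra_simps)
    qed
  qed
  then show ?thesis
    by blast
qed

text \<open>\<open>Q L'\<close> is required on a whole cylinder because later steps alter
  \<open>y\<close> from position \<open>L'\<close> on; only a property of the cylinder survives in
  the limit. Dependent choice iterates the step on pairs of a point and the length of its frozen
  prefix.\<close>

lemma glued_point:
  assumes X: "subshift X"
    and "x\<^sub>0 \<in> X"
    and step: "\<And>x L. x \<in> X \<Longrightarrow> L \<ge> 1 \<Longrightarrow>
      \<exists>y\<in>X. \<exists>L'>L. (\<forall>i<L. y i = x i) \<and> (\<forall>z\<in>X. (\<forall>i<L'. z i = y i) \<longrightarrow> Q L' z)"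
  shows "\<exists>z\<in>X. \<exists>\<^sub>\<infinity>n. Q n z"
proof -
  define P where "P = (\<lambda>(x, L). x \<in> X \<and> L \<ge> (1::nat))"
  define R where "R = (\<lambda>(x, L) (y, L'). L < L' \<and> (\<forall>i<L. y i = x i) \<and>
    (\<forall>z\<in>X. (\<forall>i<L'. z i = y i) \<longrightarrow> Q L' z))"
  have "\<exists>s. \<forall>j. P (s j) \<and> R (s j) (s (Suc j))"
  proof (rule dependent_nat_choice)
    show "\<exists>a. P a"
      using \<open>x\<^sub>0 \<in> X\<close> by (auto simp: P_def)
    show "\<exists>b. P b \<and> R a b" if a: "P a" for a
    proof (cases a)
      case (Pair x L)
      then obtain y L' where "y \<in> X" "L < L'" "\<forall>i<L. y i = x i"
          "\<forall>z\<in>X. (\<forall>i<L'. z i = y i) \<longrightarrow> Q L' z"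
        using step[of x L] a by (auto simp: P_def)
      then show ?thesis
        using Pair by (intro exI[of _ "(y, L')"]) (auto simp: P_def R_def)
    qed
  qed
  then obtain s where s: "\<And>j. P (s j)" "\<And>j. R (s j) (s (Suc j))"
    by blast
  define x L where "x j = fst (s j)" and "L j = snd (s j)" for j
  have x: "x j \<in> X" and L_Suc: "L j < L (Suc j)" and agree_Suc: "i < L j \<Longrightarrow> x (Suc j) i = x j i"
    and Q: "\<And>z. z \<in> X \<Longrightarrow> \<forall>i<L (Suc j). z i = x (Suc j) i \<Longrightarrow> Q (L (Suc j)) z" for i j
    using s[of j] by (auto simp: P_def R_def x_def L_def split: prod.splits)
  have L: "strict_mono L"
    using L_Suc by (simp add: strict_mono_Suc_iff)
  have agree: "x k i = x j i" if "j \<le> k" "i < L j" for i j k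
    using that(1)
  proof (induction k rule: dec_induct)
    case (step k)
    then have "i < L k"
      using that(2) strict_mono_less_eq[OF L] by (meson order_less_le_trans)
    then show ?case
      using step agree_Suc by simp
  qed simp
  have less_L: "i < L (Suc i)" for i
    using strict_mono_imp_increasing[OF L, of "Suc i"] by simp
  \<comment> \<open>Coordinate \<open>i\<close> is frozen once the prefix is longer than
    \<open>i\<close>, which by \<open>less_L\<close> holds from stage \<open>Suc i\<close>
    on.\<close>
  define z where "z i = x (Suc i) i" for i
  have z_agree: "z i = x j i" if "i < L j" for i j
    using agree[of j "Suc i" i] agree[of "Suc i" j i] that less_L
    by (cases "j \<le> Suc i") (auto simp: z_def)
  have "z \<in> X"
  proof (rule subshift_limit_mem[OF X x])
    show "\<forall>\<^sub>F j in sequentially. x j i = z i" for i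
      using eventually_ge_at_top[of "Suc i"]
      by eventually_elim (simp add: z_def agree less_L)
  qed
  moreover have "\<exists>n>k. Q n z" for k
    using Q[OF \<open>z \<in> X\<close>, of k] z_agree less_L by blast
  then have "\<exists>\<^sub>\<infinity>n. Q n z"
    by (simp add: INFM_nat)
  ultimately show ?thesis
    by blast
qed

text \<open>If \<open>g n\<close> were too negative on arbitrarily bad cylinders, gluing such cylinders one after the
  other, each bad enough to outweigh everything before it, would produce a single point at which
  \<open>g n / n\<close> does not tend to 0.\<close>

lemma subadditive_uniform_lower_bound:
  fixes g :: "nat \<Rightarrow> (nat \<Rightarrow> nat) \<Rightarrow> real"
  assumes X: "subshift X"
    and sub: "\<And>n k x. n \<ge> 1 \<Longrightarrow> k \<ge> 1 \<Longrightarrow> x \<in> X \<Longrightarrow>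
      g (n + k) x \<le> g n x + g k ((shift_map ^^ n) x) + C"
    and upper: "\<And>\<epsilon>. \<epsilon> > 0 \<Longrightarrow> \<exists>K. \<forall>n\<ge>1. \<forall>x\<in>X. g n x \<le> \<epsilon> * real n + K"
    and var: "\<And>\<epsilon>. \<epsilon> > 0 \<Longrightarrow> \<exists>K. \<forall>n\<ge>1. \<forall>x\<in>X. \<forall>y\<in>X. (\<forall>i<n. x i = y i) \<longrightarrow>
      g n x \<le> g n y + \<epsilon> * real n + K"
    and glue: "\<And>n k x y. n \<ge> 1 \<Longrightarrow> k \<ge> 1 \<Longrightarrow> x \<in> X \<Longrightarrow> y \<in> X \<Longrightarrow>
      \<exists>l\<le>p. \<exists>z\<in>X. (\<forall>i<n. z i = x i) \<and> (\<forall>i<k. z (n + l + i) = y i)"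
    and lim: "\<And>x. x \<in> X \<Longrightarrow> (\<lambda>n. g n x / real n) \<longlonglongrightarrow> 0"
    and "\<epsilon> > 0"
  shows "\<exists>K. \<forall>n\<ge>1. \<forall>x\<in>X. - (\<epsilon> * real n + K) \<le> g n x"
proof (rule ccontr)
  assume "\<not> ?thesis"
  then have bad: "\<exists>n\<ge>1. \<exists>y\<in>X. g n y < - (\<epsilon> * real n + K)" for K
    by (meson not_le)
  obtain K\<^sub>0 where K\<^sub>0: "\<And>n x. n \<ge> 1 \<Longrightarrow> x \<in> X \<Longrightarrow> g n x \<le> \<epsilon> / 2 * real n + K\<^sub>0"
    using upper[of "\<epsilon> / 2"] \<open>\<epsilon> > 0\<close> by auto
  obtain K\<^sub>1 where "\<forall>n\<ge>1. \<forall>x\<in>X. \<forall>y\<in>X. (\<forall>i<n. x i = y i) \<longrightarrow>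
      g n x \<le> g n y + \<epsilon> / 2 * real n + K\<^sub>1"
    using var[OF half_gt_zero[OF \<open>\<epsilon> > 0\<close>]] by blast
  then have K\<^sub>1: "n \<ge> 1 \<Longrightarrow> x \<in> X \<Longrightarrow> y \<in> X \<Longrightarrow> \<forall>i<n. x i = y i \<Longrightarrow>
      g n x \<le> g n y + \<epsilon> / 2 * real n + K\<^sub>1" for n x y
    by blast
  define Q where "Q n z \<longleftrightarrow> g n z \<le> - (\<epsilon> / 2 * real n)" for n z
  have "\<exists>z\<in>X. \<exists>\<^sub>\<infinity>n. Q n z"
  proof (rule glued_point[OF X])
    \<comment> \<open>The failing bound already provides a point of \<open>X\<close>.\<close>
    show "(SOME x. x \<in> X) \<in> X"
      using bad[of 0] by (metis someI)
    fix x L assume x: "x \<in> X" and L: "(1::nat) \<le> L"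
    \<comment> \<open>The constant is chosen with \<open>L\<close> known. Prefix and gap have length
      at most \<open>L + p\<close>: one half of \<open>\<epsilon> * real (L + p)\<close> cancels the
      upper bound of \<open>g\<close> there, the other half supplies the decrease that
      \<open>Q\<close> demands over them. The remaining summands cancel the additive errors.\<close>
    obtain n y where n: "n \<ge> 1" and y: "y \<in> X"
        "g n y < - (\<epsilon> * real n + (\<epsilon> * real (L + p) + K\<^sub>0 + K\<^sub>1 + C))"
      using bad by blast
    obtain l z where l: "l \<le> p" and z: "z \<in> X" "\<forall>i<L. z i = x i" "\<forall>i<n. z (L + l + i) = y i"
      using glue[OF L n x y(1)] by blast
    have "Q (L + l + n) w" if w: "w \<in> X" "\<forall>i<L + l + n. w i = z i" for w
    proof -
      let ?w = "(shift_map ^^ (L + l)) w"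
      have "g (L + l + n) w \<le> g (L + l) w + g n ?w + C"
        using sub[of "L + l" n w] L n w by simp
      also have "g (L + l) w \<le> \<epsilon> / 2 * real (L + l) + K\<^sub>0"
        using K\<^sub>0[of "L + l" w] L w by simp
      \<comment> \<open>\<open>?w\<close> follows \<open>y\<close> for \<open>n\<close> coordinates
        only; moving the bad value from \<open>y\<close> to \<open>?w\<close> uses up half of the
        decrease \<open>\<epsilon> * real n\<close>.\<close>
      also have "g n ?w \<le> g n y + \<epsilon> / 2 * real n + K\<^sub>1"
      proof (rule K\<^sub>1[OF n _ y(1)])
        show "?w \<in> X"
          using subshift_funpow_mem[OF X w(1)] .
        show "\<forall>i<n. ?w i = y i"
          using w(2) z(3) by (auto simp: shift_map_funpow add_ac)
      qed
      finally have "g (L + l + n) w \<le> \<epsilon> / 2 * real (L + l) + K\<^sub>0 + (g n y + \<epsilon> / 2 * real n + K\<^sub>1) + C"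
        by simp
      moreover have "\<epsilon> * real (L + l) \<le> \<epsilon> * real (L + p)"
        using l \<open>\<epsilon> > 0\<close> by simp
      moreover have "\<epsilon> / 2 * real (L + l + n) = \<epsilon> * real (L + l) / 2 + \<epsilon> * real n / 2"
        by (simp add: field_simps)
      ultimately show ?thesis
        using y(2) unfolding Q_def by linarith
    qed
    then show "\<exists>y\<in>X. \<exists>L'>L. (\<forall>i<L. y i = x i) \<and> (\<forall>z\<in>X. (\<forall>i<L'. z i = y i) \<longrightarrow> Q L' z)"
      using z n by (intro bexI[of _ z] exI[of _ "L + l + n"]) auto
  qed
  then obtain z where z: "z \<in> X" "\<exists>\<^sub>\<infinity>n. Q n z"
    by blast
  have "\<forall>\<^sub>F n in sequentially. g n z / real n > - (\<epsilon> / 2)"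
    using order_tendstoD(1)[OF lim[OF z(1)], of "- (\<epsilon> / 2)"] \<open>\<epsilon> > 0\<close> by simp
  then have "\<forall>\<^sub>F n in sequentially. \<not> Q n z"
    using eventually_gt_at_top[of 0] by eventually_elim (auto simp: Q_def field_simps)
  then show False
    using z(2) by (simp add: frequently_def cofinite_eq_sequentially)
qed

text \<open>(C2) speaks of words, which may occur at any position \<open>j\<close> of a point
  \<open>z\<close>; shift invariance moves the occurrence to the start of
  \<open>(shift_map ^^ j) z\<close>.\<close>

lemma condition_C2_glue:
  assumes X: "subshift X" and "condition_C2 X f"
  obtains p where "\<And>n k x y. n \<ge> 1 \<Longrightarrow> k \<ge> 1 \<Longrightarrow> x \<in> X \<Longrightarrow> y \<in> X \<Longrightarrow>
      \<exists>l\<le>p. \<exists>z\<in>X. (\<forall>i<n. z i = x i) \<and> (\<forall>i<k. z (n + l + i) = y i)"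
proof -
  obtain p where p: "\<And>n k u v. n \<ge> 1 \<Longrightarrow> k \<ge> 1 \<Longrightarrow> u \<in> words X n \<Longrightarrow> v \<in> words X k \<Longrightarrow>
      \<exists>l\<le>p. \<exists>w\<in>words X l. u @ w @ v \<in> words X (n + l + k)"
    using assms(2) unfolding condition_C2_def by meson
  have "\<exists>l\<le>p. \<exists>z\<in>X. (\<forall>i<n. z i = x i) \<and> (\<forall>i<k. z (n + l + i) = y i)"
    if nk: "n \<ge> 1" "k \<ge> 1" and xy: "x \<in> X" "y \<in> X" for n k x y
  proof -
    have uv: "map x [0..<n] \<in> words X n" "map y [0..<k] \<in> words X k"
      using xy unfolding words_def by (metis (mono_tags, lifting) add_0 mem_Collect_eq)+
    obtain l w where l: "l \<le> p" "w \<in> words X l"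
        "map x [0..<n] @ w @ map y [0..<k] \<in> words X (n + l + k)"
      using p[OF nk uv] by blast
    have "length w = l"
      using l(2) by (auto simp: words_def)
    obtain z j where z: "z \<in> X" and eq: "map x [0..<n] @ w @ map y [0..<k] = map z [j..<j + (n + l + k)]"
      using l(3) by (auto simp: words_def)
    have "z (j + i) = x i" if "i < n" for i
      using arg_cong[OF eq, of "\<lambda>u. u ! i"] that by (simp add: nth_append)
    moreover have "z (j + (n + l + i)) = y i" if "i < k" for i
      using arg_cong[OF eq, of "\<lambda>u. u ! (n + l + i)"] that \<open>length w = l\<close> by (simp add: nth_append)
    ultimately show ?thesis
      using l(1) subshift_funpow_mem[OF X z, of j]
      by (intro exI[of _ l] conjI bexI[of _ "(shift_map ^^ j) z"]) (auto simp: shift_map_funpow add_ac)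
  qed
  then show ?thesis
    using that by blast
qed

section \<open>Pointwise and uniform approximation by Birkhoff sums\<close>

text \<open>Uniform o(n) approximation, written without a supremum so that no boundedness has to be
  carried along; \<open>eventually\<close> disregards the unconstrained \<open>f 0\<close>.\<close>

definition additively_approximated ::
    "(nat \<Rightarrow> nat) set \<Rightarrow> (nat \<Rightarrow> (nat \<Rightarrow> nat) \<Rightarrow> real) \<Rightarrow> ((nat \<Rightarrow> nat) \<Rightarrow> real) \<Rightarrow> bool" where
  "additively_approximated X f h \<longleftrightarrow>
     (\<forall>\<epsilon>>0. \<forall>\<^sub>F n in sequentially. \<forall>x\<in>X. \<bar>ln (f n x) - birkhoff_sum n h x\<bar> \<le> \<epsilon> * real n)"

text \<open>Birkhoff sums are additive, so subtracting them keeps the defect \<open>C\<close> of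
  subadditivity. On a cylinder of length \<open>n\<close> the difference varies by at most
  \<open>ln B\<close>, from bounded variation, plus \<open>\<epsilon> * real n + K\<close>, from
  uniform continuity of \<open>h\<close>; so both uniform bounds apply.\<close>

lemma approximated_if_pointwise:
  assumes X: "subshift X" and f: "log_sequence X f"
    and bv: "bounded_variation_seq X f" and C1: "condition_C1 X f" and C2: "condition_C2 X f"
    and h: "continuous_on X h"
    and lim: "\<And>x. x \<in> X \<Longrightarrow> (\<lambda>n. 1 / real n * ln (f n x / exp (birkhoff_sum n h x))) \<longlonglongrightarrow> 0"
  shows "additively_approximated X f h"
proof -
  define g where "g n x = ln (f n x) - birkhoff_sum n h x" for n x
  have f_pos: "f n x > 0" if "n \<ge> 1" "x \<in> X" for n x
    using f that by (auto simp: log_sequence_def)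
  obtain C where C: "\<And>n k x. n \<ge> 1 \<Longrightarrow> k \<ge> 1 \<Longrightarrow> x \<in> X \<Longrightarrow>
      exp C * f (n + k) x \<le> exp C * f n x * (exp C * f k ((shift_map ^^ n) x))"
    using C1 unfolding condition_C1_def subadditive_def by blast
  have sub: "g (n + k) x \<le> g n x + g k ((shift_map ^^ n) x) + C"
    if nk: "n \<ge> 1" "k \<ge> 1" "x \<in> X" for n k x
  proof -
    let ?y = "(shift_map ^^ n) x"
    have pos: "f (n + k) x > 0" "f n x > 0" "f k ?y > 0"
      using nk subshift_funpow_mem[OF X \<open>x \<in> X\<close>] by (auto intro: f_pos)
    \<comment> \<open>\<open>exp C\<close> occurs once on the left and twice on the right, so one
      factor survives.\<close>
    have "f (n + k) x \<le> f n x * f k ?y * exp C"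
      using C[OF nk] by (simp add: mult_ac)
    then have "ln (f (n + k) x) \<le> ln (f n x * f k ?y * exp C)"
      using pos by simp
    also have "\<dots> = ln (f n x) + ln (f k ?y) + C"
      using pos by (simp add: ln_mult)
    finally show ?thesis
      by (simp add: g_def birkhoff_sum_add)
  qed
  have cont: "continuous_on X (g n)" if "n \<ge> 1" for n
    using f f_pos that birkhoff_sum_continuous[OF X h] unfolding g_def log_sequence_def
    by (intro continuous_on_diff continuous_on_ln) (auto simp: less_imp_neq[symmetric])
  have g_lim: "(\<lambda>n. g n x / real n) \<longlonglongrightarrow> 0" if "x \<in> X" for x
  proof (rule Lim_transform_eventually[OF lim[OF that]])
    show "\<forall>\<^sub>F n in sequentially. 1 / real n * ln (f n x / exp (birkhoff_sum n h x)) = g n x / real n"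
      using eventually_ge_at_top[of 1]
    proof eventually_elim
      case (elim n)
      then show ?case
        using f_pos[OF elim that] by (simp add: g_def ln_div)
    qed
  qed
  have upper: "\<exists>K. \<forall>n\<ge>1. \<forall>x\<in>X. g n x \<le> \<epsilon> * real n + K" if "\<epsilon> > 0" for \<epsilon>
    by (rule subadditive_uniform_upper_bound[where T = shift_map, OF subshift_compact[OF X]])
       (use sub cont g_lim subshift_funpow_mem[OF X] that in auto)
  obtain B where "\<And>r. r \<in> {f n x / f n y | n x y. n \<ge> 1 \<and> x \<in> X \<and> y \<in> X \<and> (\<forall>i<n. x i = y i)} \<Longrightarrow> r \<le> B"
    using bv unfolding bounded_variation_seq_def bdd_above_def by blast
  then have B: "f n x / f n y \<le> B" if "n \<ge> 1" "x \<in> X" "y \<in> X" "\<forall>i<n. x i = y i" for n x y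
    using that by blast
  have var: "\<exists>K. \<forall>n\<ge>1. \<forall>x\<in>X. \<forall>y\<in>X. (\<forall>i<n. x i = y i) \<longrightarrow> g n x \<le> g n y + \<epsilon> * real n + K"
    if "\<epsilon> > 0" for \<epsilon>
  proof -
    obtain K where K: "\<forall>n. \<forall>x\<in>X. \<forall>y\<in>X. (\<forall>i<n. x i = y i) \<longrightarrow>
        \<bar>birkhoff_sum n h x - birkhoff_sum n h y\<bar> \<le> \<epsilon> * real n + K"
      using birkhoff_sum_variation[OF X h \<open>\<epsilon> > 0\<close>] by blast
    have "g n x \<le> g n y + \<epsilon> * real n + (ln B + K)"
      if xy: "n \<ge> 1" "x \<in> X" "y \<in> X" "\<forall>i<n. x i = y i" for n x y
    proof -
      have pos: "f n x > 0" "f n y > 0"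
        using xy by (auto intro: f_pos)
      then have "ln (f n x / f n y) \<le> ln B"
        using B[OF xy] by (intro ln_mono) auto
      then have "ln (f n x) - ln (f n y) \<le> ln B"
        using pos by (simp add: ln_div)
      moreover have "\<bar>birkhoff_sum n h x - birkhoff_sum n h y\<bar> \<le> \<epsilon> * real n + K"
        using K xy by blast
      ultimately show ?thesis
        unfolding g_def by linarith
    qed
    then show ?thesis
      by blast
  qed
  obtain p where glue: "\<And>n k x y. n \<ge> 1 \<Longrightarrow> k \<ge> 1 \<Longrightarrow> x \<in> X \<Longrightarrow> y \<in> X \<Longrightarrow>
      \<exists>l\<le>p. \<exists>z\<in>X. (\<forall>i<n. z i = x i) \<and> (\<forall>i<k. z (n + l + i) = y i)"
    using condition_C2_glue[OF X C2] by blast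
  have lower: "\<exists>K. \<forall>n\<ge>1. \<forall>x\<in>X. - (\<epsilon> * real n + K) \<le> g n x" if "\<epsilon> > 0" for \<epsilon>
    by (rule subadditive_uniform_lower_bound[OF X sub upper var glue g_lim that])
  show ?thesis
    unfolding additively_approximated_def
  proof (intro allI impI)
    fix \<epsilon> :: real assume "\<epsilon> > 0"
    then have "\<epsilon> / 2 > 0"
      by simp
    obtain K where K: "\<forall>n\<ge>1. \<forall>x\<in>X. g n x \<le> \<epsilon> / 2 * real n + K"
      using upper[OF \<open>\<epsilon> / 2 > 0\<close>] by blast
    obtain K' where K': "\<forall>n\<ge>1. \<forall>x\<in>X. - (\<epsilon> / 2 * real n + K') \<le> g n x"
      using lower[OF \<open>\<epsilon> / 2 > 0\<close>] by blast
    obtain N where N: "real N \<ge> max K K' / (\<epsilon> / 2)"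
      using real_arch_simple by blast
    show "\<forall>\<^sub>F n in sequentially. \<forall>x\<in>X. \<bar>ln (f n x) - birkhoff_sum n h x\<bar> \<le> \<epsilon> * real n"
      using eventually_ge_at_top[of "max 1 N"]
    \<comment> \<open>From \<open>N\<close> on, the second half of
      \<open>\<epsilon> * real n\<close> absorbs \<open>K\<close> and \<open>K'\<close>.\<close>
    proof eventually_elim
      case (elim n)
      have "max K K' \<le> \<epsilon> / 2 * real N"
        using N \<open>\<epsilon> > 0\<close> by (simp add: field_simps)
      also have "\<dots> \<le> \<epsilon> / 2 * real n"
        using elim \<open>\<epsilon> > 0\<close> by simp
      finally have "max K K' \<le> \<epsilon> / 2 * real n" .
      moreover have "\<forall>x\<in>X. g n x \<le> \<epsilon> / 2 * real n + K" "\<forall>x\<in>X. - (\<epsilon> / 2 * real n + K') \<le> g n x"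
        using K K' elim by auto
      ultimately show ?case
        unfolding g_def by (fastforce simp: abs_le_iff)
    qed
  qed
qed

lemma pointwise_if_approximated:
  assumes f: "log_sequence X f" and approx: "additively_approximated X f h" and x: "x \<in> X"
  shows "(\<lambda>n. 1 / real n * ln (f n x / exp (birkhoff_sum n h x))) \<longlonglongrightarrow> 0"
proof (rule tendstoI)
  fix \<epsilon> :: real assume "\<epsilon> > 0"
  then have "\<forall>\<^sub>F n in sequentially. \<forall>x\<in>X. \<bar>ln (f n x) - birkhoff_sum n h x\<bar> \<le> \<epsilon> / 2 * real n"
    using approx half_gt_zero unfolding additively_approximated_def by blast
  then show "\<forall>\<^sub>F n in sequentially. dist (1 / real n * ln (f n x / exp (birkhoff_sum n h x))) 0 < \<epsilon>"
    using eventually_ge_at_top[of 1]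
  proof eventually_elim
    case (elim n)
    have "f n x > 0"
      using f elim(2) x by (auto simp: log_sequence_def)
    then have "\<bar>1 / real n * ln (f n x / exp (birkhoff_sum n h x))\<bar>
        = \<bar>ln (f n x) - birkhoff_sum n h x\<bar> / real n"
      by (simp add: ln_div abs_mult)
    also have "\<dots> \<le> \<epsilon> / 2"
      using elim x by (simp add: divide_le_eq)
    also have "\<dots> < \<epsilon>"
      using \<open>\<epsilon> > 0\<close> by simp
    finally show ?case
      by (simp only: dist_real_def diff_0_right)
  qed
qed

section \<open>Asymptotic additivity and a single approximating function\<close>

text \<open>A real \<open>SUP\<close> dominates the values only if they are bounded above;
  compactness ensures this.\<close>

lemma log_birkhoff_diff_bdd_above:
  assumes X: "subshift X" and f: "log_sequence X f" and h: "continuous_on X h" and "n \<ge> 1"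
  shows "bdd_above ((\<lambda>x. \<bar>ln (f n x) - birkhoff_sum n h x\<bar>) ` X)"
proof -
  have "continuous_on X (\<lambda>x. ln (f n x) - birkhoff_sum n h x)"
    using f \<open>n \<ge> 1\<close> birkhoff_sum_continuous[OF X h] unfolding log_sequence_def
    by (intro continuous_on_diff continuous_on_ln) (auto simp: less_imp_neq[symmetric])
  then obtain M where "\<And>x. x \<in> X \<Longrightarrow> \<bar>ln (f n x) - birkhoff_sum n h x\<bar> \<le> M"
    using compact_continuous_bound[OF subshift_compact[OF X]] by blast
  then show ?thesis
    by (auto simp: bdd_above_def)
qed

lemma asymptotically_additiveD:
  assumes X: "subshift X" and f: "log_sequence X f"
    and aa: "asymptotically_additive X f" and "\<epsilon> > 0"
  shows "\<exists>\<rho>. continuous_on X \<rho> \<and>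
    (\<forall>\<^sub>F n in sequentially. \<forall>x\<in>X. \<bar>ln (f n x) - birkhoff_sum n \<rho> x\<bar> \<le> \<epsilon> * real n)"
proof -
  obtain \<rho> where \<rho>: "continuous_on X \<rho>"
      "limsup (\<lambda>n. ereal (1 / real n * (SUP x\<in>X. \<bar>ln (f n x) - birkhoff_sum n \<rho> x\<bar>))) < ereal \<epsilon>"
    using aa \<open>\<epsilon> > 0\<close> unfolding asymptotically_additive_def by blast
  have "\<forall>\<^sub>F n in sequentially. \<forall>x\<in>X. \<bar>ln (f n x) - birkhoff_sum n \<rho> x\<bar> \<le> \<epsilon> * real n"
    using Limsup_lessD[OF \<rho>(2)] eventually_ge_at_top[of 1]
  proof eventually_elim
    case (elim n)
    then have "(SUP x\<in>X. \<bar>ln (f n x) - birkhoff_sum n \<rho> x\<bar>) \<le> \<epsilon> * real n"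
      by (simp add: field_simps)
    then show ?case
      using cSUP_upper[OF _ log_birkhoff_diff_bdd_above[OF X f \<rho>(1) elim(2)]] by fastforce
  qed
  then show ?thesis
    using \<rho>(1) by blast
qed

lemma approximated_imp_SUP_le:
  assumes approx: "additively_approximated X f h" and "X \<noteq> {}" and "\<epsilon> > 0"
  shows "\<forall>\<^sub>F n in sequentially. 1 / real n * (SUP x\<in>X. \<bar>ln (f n x) - birkhoff_sum n h x\<bar>) \<le> \<epsilon>"
proof -
  have "\<forall>\<^sub>F n in sequentially. \<forall>x\<in>X. \<bar>ln (f n x) - birkhoff_sum n h x\<bar> \<le> \<epsilon> * real n"
    using approx \<open>\<epsilon> > 0\<close> by (auto simp: additively_approximated_def)
  then show ?thesis
    using eventually_ge_at_top[of 1]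
  proof eventually_elim
    case (elim n)
    then have "(SUP x\<in>X. \<bar>ln (f n x) - birkhoff_sum n h x\<bar>) \<le> \<epsilon> * real n"
      using \<open>X \<noteq> {}\<close> by (intro cSUP_least) auto
    then show ?case
      using elim(2) by (simp add: field_simps)
  qed
qed

lemma asymptotically_additive_if_approximated:
  assumes h: "continuous_on X h" and approx: "additively_approximated X f h" and "X \<noteq> {}"
  shows "asymptotically_additive X f"
  unfolding asymptotically_additive_def
proof (intro allI impI exI[of _ h] conjI h)
  fix \<epsilon> :: real assume "\<epsilon> > 0"
  then have "limsup (\<lambda>n. ereal (1 / real n * (SUP x\<in>X. \<bar>ln (f n x) - birkhoff_sum n h x\<bar>)))
      \<le> ereal (\<epsilon> / 2)"
    using approximated_imp_SUP_le[OF approx \<open>X \<noteq> {}\<close>, of "\<epsilon> / 2"] by (intro Limsup_bounded) simp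
  also have "\<dots> < ereal \<epsilon>"
    using \<open>\<epsilon> > 0\<close> by simp
  finally show "limsup (\<lambda>n. ereal (1 / real n * (SUP x\<in>X. \<bar>ln (f n x) - birkhoff_sum n h x\<bar>)))
      < ereal \<epsilon>" .
qed

text \<open>Exchanging the sums turns the left term into the mean over \<open>j < N\<close> of
  \<open>birkhoff_sum n \<phi>\<close> at the \<open>j\<close>-th shift of \<open>x\<close>.
  Splitting the sum of length \<open>n + j\<close> in two ways shows that each of these differs from
  the sum at \<open>x\<close> by two sums of length \<open>j\<close>, whatever \<open>n\<close>
  is.\<close>

lemma birkhoff_sum_average:
  assumes X: "subshift X" and x: "x \<in> X" and M: "\<And>y. y \<in> X \<Longrightarrow> \<bar>\<phi> y\<bar> \<le> M" and "N \<ge> 1"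
  shows "\<bar>birkhoff_sum n (\<lambda>y. birkhoff_sum N \<phi> y / real N) x - birkhoff_sum n \<phi> x\<bar> \<le> 2 * real N * M"
proof -
  have "M \<ge> 0"
    using M[OF x] by simp
  have "birkhoff_sum n (\<lambda>y. birkhoff_sum N \<phi> y) x = (\<Sum>j<N. birkhoff_sum n \<phi> ((shift_map ^^ j) x))"
    unfolding birkhoff_sum_def
    by (subst sum.swap) (simp add: shift_map_funpow add_ac)
  then have eq: "birkhoff_sum n (\<lambda>y. birkhoff_sum N \<phi> y / real N) x - birkhoff_sum n \<phi> x
      = (\<Sum>j<N. birkhoff_sum n \<phi> ((shift_map ^^ j) x) - birkhoff_sum n \<phi> x) / real N"
    using \<open>N \<ge> 1\<close> by (simp add: birkhoff_sum_def sum_subtractf diff_divide_distrib flip: sum_divide_distrib)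
  have "\<bar>birkhoff_sum n \<phi> ((shift_map ^^ j) x) - birkhoff_sum n \<phi> x\<bar> \<le> 2 * real N * M" if "j < N" for j
  proof -
    have "birkhoff_sum n \<phi> ((shift_map ^^ j) x) - birkhoff_sum n \<phi> x
        = birkhoff_sum j \<phi> ((shift_map ^^ n) x) - birkhoff_sum j \<phi> x"
      using birkhoff_sum_add[of n j \<phi> x] birkhoff_sum_add[of j n \<phi> x] by (simp add: add.commute)
    moreover have bound: "\<bar>birkhoff_sum j \<phi> y\<bar> \<le> real N * M" if y: "y \<in> X" for y
    proof -
      have "\<bar>birkhoff_sum j \<phi> y\<bar> \<le> real j * M"
        using birkhoff_sum_bound[OF X y M] .
      also have "\<dots> \<le> real N * M"
        using \<open>j < N\<close> \<open>M \<ge> 0\<close> by (intro mult_right_mono) auto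
      finally show ?thesis .
    qed
    ultimately show ?thesis
      using bound[OF x] bound[OF subshift_funpow_mem[OF X x, of n]] by linarith
  qed
  then have "\<bar>\<Sum>j<N. birkhoff_sum n \<phi> ((shift_map ^^ j) x) - birkhoff_sum n \<phi> x\<bar>
      \<le> (\<Sum>j<N. 2 * real N * M)"
    by (intro order_trans[OF sum_abs] sum_mono) auto
  then show ?thesis
    unfolding eq using \<open>N \<ge> 1\<close> by (simp add: abs_divide divide_le_eq mult_ac)
qed

text \<open>Cuneo's argument: the increments \<open>\<rho> (Suc k) - \<rho> k\<close> need not be small, but their long
  Birkhoff averages are, and replacing a function by such an average changes its Birkhoff sums only
  by a bounded amount.\<close>

lemma approximated_if_asymptotically_additive:
  assumes X: "subshift X" and f: "log_sequence X f" and aa: "asymptotically_additive X f"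
  shows "\<exists>h. continuous_on X h \<and> additively_approximated X f h"
proof -
  have "\<forall>k. \<exists>\<rho>. continuous_on X \<rho> \<and> (\<forall>\<^sub>F n in sequentially.
      \<forall>x\<in>X. \<bar>ln (f n x) - birkhoff_sum n \<rho> x\<bar> \<le> (1/2) ^ k * real n)"
    using asymptotically_additiveD[OF X f aa] by simp
  from choice[OF this] obtain \<rho> where \<rho>_cont: "\<And>k. continuous_on X (\<rho> k)"
    and \<rho>: "\<And>k. \<forall>\<^sub>F n in sequentially. \<forall>x\<in>X. \<bar>ln (f n x) - birkhoff_sum n (\<rho> k) x\<bar> \<le> (1/2) ^ k * real n"
    by blast
  define \<phi> where "\<phi> k x = \<rho> (Suc k) x - \<rho> k x" for k x
  have \<phi>_cont: "continuous_on X (\<phi> k)" for k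
    unfolding \<phi>_def by (intro continuous_on_diff \<rho>_cont)
  have \<phi>_sum: "birkhoff_sum n (\<phi> k) x = birkhoff_sum n (\<rho> (Suc k)) x - birkhoff_sum n (\<rho> k) x" for n k x
    by (simp add: birkhoff_sum_def \<phi>_def sum_subtractf)
  \<comment> \<open>\<open>\<rho> k\<close> and \<open>\<rho> (Suc k)\<close> both approximate
    \<open>ln (f n x)\<close>, with errors adding up to at most twice \<open>(1/2) ^ k\<close> per
    step. One such length suffices for the average.\<close>
  have "\<exists>N\<ge>1. \<forall>x\<in>X. \<bar>birkhoff_sum N (\<phi> k) x\<bar> \<le> 2 * (1/2) ^ k * real N" for k
  proof -
    have "\<forall>\<^sub>F n in sequentially. n \<ge> 1 \<and> (\<forall>x\<in>X. \<bar>birkhoff_sum n (\<phi> k) x\<bar> \<le> 2 * (1/2) ^ k * real n)"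
      using \<rho>[of k] \<rho>[of "Suc k"] eventually_ge_at_top[of 1]
    proof eventually_elim
      case (elim n)
      have "\<bar>birkhoff_sum n (\<phi> k) x\<bar> \<le> 2 * (1/2) ^ k * real n" if "x \<in> X" for x
      proof -
        have "(1/2) ^ k * real n \<ge> 0" "(1/2) ^ Suc k * real n = (1/2) ^ k * real n / 2"
          by simp_all
        then show ?thesis
          using elim(1,2)[rule_format, OF that] unfolding \<phi>_sum by linarith
      qed
      then show ?case
        using elim(3) by blast
    qed
    then show ?thesis
      by (auto dest: eventually_happens)
  qed
  then obtain N where N: "\<And>k. N k \<ge> 1"
      "\<And>k x. x \<in> X \<Longrightarrow> \<bar>birkhoff_sum (N k) (\<phi> k) x\<bar> \<le> 2 * (1/2) ^ k * real (N k)"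
    by metis
  define d where "d k x = birkhoff_sum (N k) (\<phi> k) x / real (N k)" for k x
  have d_cont: "continuous_on X (d k)" for k
    unfolding d_def using N(1)[of k]
    by (intro continuous_on_divide birkhoff_sum_continuous[OF X \<phi>_cont] continuous_on_const) auto
  have d_le: "\<bar>d k x\<bar> \<le> 2 * (1/2) ^ k" if "x \<in> X" for k x
    using N(1)[of k] N(2)[OF that, of k] by (simp add: d_def divide_le_eq)
  have summable_pow: "summable (\<lambda>k. 2 * (1/2::real) ^ k)"
    by (intro summable_mult summable_geometric) simp
  \<comment> \<open>The series of the \<open>\<phi> k\<close> telescopes but need not converge; the
    averages \<open>d k\<close> are summable in the supremum norm.\<close>
  define h where "h x = \<rho> 0 x + (\<Sum>k. d k x)" for x
  have "uniform_limit X (\<lambda>n x. \<Sum>k<n. d k x) (\<lambda>x. \<Sum>k. d k x) sequentially"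
    using d_le by (intro Weierstrass_m_test[OF _ summable_pow]) simp
  then have h_cont: "continuous_on X h"
    unfolding h_def
    by (intro continuous_on_add \<rho>_cont uniform_limit_theorem[where F = sequentially])
       (auto intro!: always_eventually continuous_on_sum d_cont)
  define s where "s K x = \<rho> 0 x + (\<Sum>k<K. d k x)" for K x
  have tail: "\<bar>h x - s K x\<bar> \<le> 4 * (1/2) ^ K" if "x \<in> X" for K x
  proof -
    have summable_d: "summable (\<lambda>k. d k x)"
      using d_le[OF that] by (intro summable_comparison_test'[OF summable_pow]) simp
    have pow_sums: "(\<lambda>k. 2 * (1/2::real) ^ (k + K)) sums (4 * (1/2) ^ K)"
      using sums_mult[OF geometric_sums[of "1/2::real"], of "2 * (1/2) ^ K"]
      by (simp add: power_add mult_ac)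
    have "h x - s K x = (\<Sum>k. d (k + K) x)"
      using suminf_split_initial_segment[OF summable_d, of K] by (simp add: h_def s_def)
    moreover have "norm (\<Sum>k. d (k + K) x) \<le> (\<Sum>k. 2 * (1/2) ^ (k + K))"
      using d_le[OF that] by (intro norm_suminf_le sums_summable[OF pow_sums]) simp
    ultimately show ?thesis
      using sums_unique[OF pow_sums] by simp
  qed
  \<comment> \<open>With \<open>\<phi>\<close> in place of \<open>d\<close>, the partial sum would
    be exactly \<open>\<rho> K\<close>; each replacement costs a constant independent of
    \<open>n\<close>, so \<open>B\<close> depends on \<open>K\<close> only.\<close>
  have s_bound: "\<exists>B. \<forall>n. \<forall>x\<in>X. \<bar>birkhoff_sum n (s K) x - birkhoff_sum n (\<rho> K) x\<bar> \<le> B" for K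
  proof (induction K)
    case 0
    then show ?case
      by (intro exI[of _ 0]) (simp add: s_def birkhoff_sum_def)
  next
    case (Suc K)
    then obtain B where B: "\<And>n x. x \<in> X \<Longrightarrow> \<bar>birkhoff_sum n (s K) x - birkhoff_sum n (\<rho> K) x\<bar> \<le> B"
      by blast
    obtain M where M: "\<And>x. x \<in> X \<Longrightarrow> \<bar>\<phi> K x\<bar> \<le> M"
      using compact_continuous_bound[OF subshift_compact[OF X] \<phi>_cont[of K]] by blast
    have "\<bar>birkhoff_sum n (s (Suc K)) x - birkhoff_sum n (\<rho> (Suc K)) x\<bar> \<le> B + 2 * real (N K) * M"
      if "x \<in> X" for n x
    proof -
      have "birkhoff_sum n (s (Suc K)) x = birkhoff_sum n (s K) x + birkhoff_sum n (d K) x"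
        by (simp add: birkhoff_sum_def s_def add.assoc flip: sum.distrib)
      moreover have "\<bar>birkhoff_sum n (d K) x - birkhoff_sum n (\<phi> K) x\<bar> \<le> 2 * real (N K) * M"
        using birkhoff_sum_average[where \<phi> = "\<phi> K", OF X that M N(1)] unfolding d_def by blast
      ultimately show ?thesis
        using B[OF that, of n] unfolding \<phi>_sum by linarith
    qed
    then show ?case
      by blast
  qed
  have "additively_approximated X f h"
    unfolding additively_approximated_def
  proof (intro allI impI)
    fix \<epsilon> :: real assume "\<epsilon> > 0"
    \<comment> \<open>Of six parts, four cover the tail \<open>4 * (1/2) ^ K\<close>, one the error
      of \<open>\<rho> K\<close>, and one \<open>B\<close>.\<close>
    then obtain K where K: "(1/2) ^ K < \<epsilon> / 6"
      using real_arch_pow_inv[of "\<epsilon> / 6" "1/2"] by auto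
    obtain B where B: "\<And>n x. x \<in> X \<Longrightarrow> \<bar>birkhoff_sum n (s K) x - birkhoff_sum n (\<rho> K) x\<bar> \<le> B"
      using s_bound by blast
    obtain n\<^sub>0 where n\<^sub>0: "real n\<^sub>0 \<ge> B / (\<epsilon> / 6)"
      using real_arch_simple by blast
    show "\<forall>\<^sub>F n in sequentially. \<forall>x\<in>X. \<bar>ln (f n x) - birkhoff_sum n h x\<bar> \<le> \<epsilon> * real n"
      using \<rho>[of K] eventually_ge_at_top[of n\<^sub>0]
    proof eventually_elim
      case (elim n)
      have "B \<le> \<epsilon> / 6 * real n\<^sub>0"
        using n\<^sub>0 \<open>\<epsilon> > 0\<close> by (simp add: field_simps)
      also have "\<dots> \<le> \<epsilon> / 6 * real n"
        using elim(2) \<open>\<epsilon> > 0\<close> by simp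
      finally have B_le: "B \<le> \<epsilon> / 6 * real n" .
      have pow_le: "(1/2) ^ K * real n \<le> \<epsilon> / 6 * real n"
        using K by (intro mult_right_mono) auto
      show ?case
      proof
        fix x assume x: "x \<in> X"
        have "birkhoff_sum n h x - birkhoff_sum n (s K) x = birkhoff_sum n (\<lambda>y. h y - s K y) x"
          by (simp add: birkhoff_sum_def sum_subtractf)
        then have "\<bar>birkhoff_sum n h x - birkhoff_sum n (s K) x\<bar> \<le> real n * (4 * (1/2) ^ K)"
          using birkhoff_sum_bound[OF X x tail] by simp
        moreover have "\<bar>ln (f n x) - birkhoff_sum n (\<rho> K) x\<bar> \<le> (1/2) ^ K * real n"
          using elim(1) x by blast
        moreover have "real n * (4 * (1/2) ^ K) = 4 * ((1/2) ^ K * real n)"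
          by simp
        ultimately show "\<bar>ln (f n x) - birkhoff_sum n h x\<bar> \<le> \<epsilon> * real n"
          using B[OF x, of n] B_le pow_le by linarith
      qed
    qed
  qed
  then show ?thesis
    using h_cont by blast
qed

section \<open>Words, cylinders and pressure\<close>

lemma finite_words:
  assumes "subshift X"
  shows "finite (words X n)"
proof -
  obtain k where "\<forall>x\<in>X. \<forall>i. x i \<in> {1..k}"
    using assms by (auto simp: subshift_def)
  then have "words X n \<subseteq> {u. set u \<subseteq> {1..k} \<and> length u = n}"
    unfolding words_def by fastforce
  then show ?thesis
    by (rule finite_subset) (intro finite_lists_length_eq finite_atLeastAtMost)
qed

lemma words_cylinder_nonempty:
  assumes "subshift X" "u \<in> words X n"
  shows "length u = n" "cylinder X u \<noteq> {}"
proof -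
  obtain x i where "x \<in> X" and u: "u = map x [i..<i + n]"
    using assms(2) by (auto simp: words_def)
  then show "length u = n"
    by simp
  have "(shift_map ^^ i) x \<in> cylinder X u"
    using subshift_funpow_mem[OF assms(1) \<open>x \<in> X\<close>, of i]
    by (simp add: cylinder_def u shift_map_funpow add.commute)
  then show "cylinder X u \<noteq> {}"
    by blast
qed

lemma cylinder_bdd_above:
  assumes X: "subshift X" and f: "log_sequence X f" and "n \<ge> 1"
  shows "bdd_above (f n ` cylinder X u)"
proof -
  have "compact (f n ` X)"
    using f \<open>n \<ge> 1\<close> by (intro compact_continuous_image subshift_compact X) (auto simp: log_sequence_def)
  then have "bdd_above (f n ` X)"
    by (intro bounded_imp_bdd_above compact_imp_bounded)
  then show ?thesis
    by (rule bdd_above_mono) (auto simp: cylinder_def)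
qed

lemma cylinder_sup_sum_pos:
  assumes X: "subshift X" "X \<noteq> {}" and f: "log_sequence X f" and "n \<ge> 1"
  shows "(\<Sum>u\<in>words X n. cylinder_sup X f u) > 0"
proof (rule sum_pos[OF finite_words[OF X(1)]])
  show "words X n \<noteq> {}"
    using \<open>X \<noteq> {}\<close> by (auto simp: words_def)
  fix u assume "u \<in> words X n"
  then obtain x where u: "length u = n" "x \<in> cylinder X u"
    using words_cylinder_nonempty[OF X(1)] by blast
  then have "0 < f n x"
    using f \<open>n \<ge> 1\<close> by (auto simp: log_sequence_def cylinder_def)
  also have "\<dots> \<le> cylinder_sup X f u"
    unfolding cylinder_sup_def u(1) by (intro cSUP_upper u cylinder_bdd_above X f \<open>n \<ge> 1\<close>)
  finally show "0 < cylinder_sup X f u" .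
qed

text \<open>An error \<open>\<epsilon> * real n\<close> in the logarithm changes every cylinder
  supremum, hence their sum, by at most the factor \<open>exp (\<epsilon> * real n)\<close>, and so
  the pressure by at most \<epsilon>.\<close>

lemma pressure_mono:
  assumes X: "subshift X" "X \<noteq> {}" and f: "log_sequence X f" and g: "log_sequence X g"
    and le: "\<And>\<epsilon>. \<epsilon> > 0 \<Longrightarrow>
      \<forall>\<^sub>F n in sequentially. \<forall>x\<in>X. ln (f n x) \<le> ln (g n x) + \<epsilon> * real n"
  shows "pressure X f \<le> pressure X g"
proof (rule ereal_le_epsilon2)
  fix \<epsilon> :: real assume "\<epsilon> > 0"
  define a b where "a n = 1 / real n * ln (\<Sum>u\<in>words X n. cylinder_sup X f u)"
    and "b n = 1 / real n * ln (\<Sum>u\<in>words X n. cylinder_sup X g u)" for n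
  have "\<forall>\<^sub>F n in sequentially. ereal (a n) \<le> ereal \<epsilon> + ereal (b n)"
    using le[OF \<open>\<epsilon> > 0\<close>] eventually_ge_at_top[of 1]
  proof eventually_elim
    case (elim n)
    have f_le: "f n x \<le> exp (\<epsilon> * real n) * g n x" if "x \<in> X" for x
    proof -
      have pos: "f n x > 0" "g n x > 0"
        using f g elim(2) that by (auto simp: log_sequence_def)
      then have "f n x = exp (ln (f n x))"
        by simp
      also have "\<dots> \<le> exp (ln (g n x) + \<epsilon> * real n)"
        using elim(1) that by simp
      also have "\<dots> = exp (\<epsilon> * real n) * g n x"
        using pos by (simp add: exp_add)
      finally show ?thesis .
    qed
    have "cylinder_sup X f u \<le> exp (\<epsilon> * real n) * cylinder_sup X g u" if "u \<in> words X n" for u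
      unfolding cylinder_sup_def words_cylinder_nonempty(1)[OF X(1) that]
    proof (rule cSUP_least[OF words_cylinder_nonempty(2)[OF X(1) that]])
      fix x assume x: "x \<in> cylinder X u"
      then have "f n x \<le> exp (\<epsilon> * real n) * g n x"
        by (intro f_le) (auto simp: cylinder_def)
      also have "g n x \<le> (SUP x\<in>cylinder X u. g n x)"
        by (intro cSUP_upper x cylinder_bdd_above X g elim)
      finally show "f n x \<le> exp (\<epsilon> * real n) * (SUP x\<in>cylinder X u. g n x)"
        by simp
    qed
    then have "(\<Sum>u\<in>words X n. cylinder_sup X f u)
        \<le> exp (\<epsilon> * real n) * (\<Sum>u\<in>words X n. cylinder_sup X g u)"
      unfolding sum_distrib_left by (intro sum_mono)
    then have "ln (\<Sum>u\<in>words X n. cylinder_sup X f u)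
        \<le> ln (exp (\<epsilon> * real n) * (\<Sum>u\<in>words X n. cylinder_sup X g u))"
      using cylinder_sup_sum_pos[OF X f elim(2)] by (intro ln_mono) auto
    also have "\<dots> = \<epsilon> * real n + ln (\<Sum>u\<in>words X n. cylinder_sup X g u)"
      using cylinder_sup_sum_pos[OF X g elim(2)] by (simp add: ln_mult)
    finally show ?case
      using elim(2) by (simp add: a_def b_def field_simps)
  qed
  then have "limsup (\<lambda>n. ereal (a n)) \<le> limsup (\<lambda>n. ereal \<epsilon> + ereal (b n))"
    by (rule Limsup_mono)
  also have "\<dots> = ereal \<epsilon> + limsup (\<lambda>n. ereal (b n))"
    by (rule ereal_limsup_lim_add) auto
  finally show "pressure X f \<le> pressure X g + ereal \<epsilon>"
    by (simp add: pressure_def a_def b_def add.commute)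
qed

lemma log_sequence_exp_birkhoff:
  assumes "subshift X" "continuous_on X h"
  shows "log_sequence X (\<lambda>n x. exp (birkhoff_sum n h x))"
  unfolding log_sequence_def
  by (auto intro!: continuous_on_exp birkhoff_sum_continuous assms)

text \<open>A weak Gibbs measure for \<open>h\<close> is normalised by the pressure of
  \<open>h\<close>; equality allows the constant \<open>P\<close> of \<open>f\<close> to be
  kept.\<close>

lemma pressure_eq_if_approximated:
  assumes X: "subshift X" "X \<noteq> {}" and f: "log_sequence X f"
    and h: "continuous_on X h" and approx: "additively_approximated X f h"
  shows "pressure X (\<lambda>n x. exp (birkhoff_sum n h x)) = pressure X f"
proof (rule antisym)
  have ev: "\<forall>\<^sub>F n in sequentially. \<forall>x\<in>X. \<bar>ln (f n x) - birkhoff_sum n h x\<bar> \<le> \<epsilon> * real n"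
    if "\<epsilon> > 0" for \<epsilon>
    using approx that by (auto simp: additively_approximated_def)
  show "pressure X (\<lambda>n x. exp (birkhoff_sum n h x)) \<le> pressure X f"
  proof (rule pressure_mono[OF X log_sequence_exp_birkhoff[OF X(1) h] f])
    show "\<forall>\<^sub>F n in sequentially. \<forall>x\<in>X. ln (exp (birkhoff_sum n h x)) \<le> ln (f n x) + \<epsilon> * real n"
      if "\<epsilon> > 0" for \<epsilon>
      using ev[OF that] by eventually_elim (auto simp: abs_le_iff)
  qed
  show "pressure X f \<le> pressure X (\<lambda>n x. exp (birkhoff_sum n h x))"
  proof (rule pressure_mono[OF X f log_sequence_exp_birkhoff[OF X(1) h]])
    show "\<forall>\<^sub>F n in sequentially. \<forall>x\<in>X. ln (f n x) \<le> ln (exp (birkhoff_sum n h x)) + \<epsilon> * real n"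
      if "\<epsilon> > 0" for \<epsilon>
      using ev[OF that] by eventually_elim (auto simp: abs_le_iff)
  qed
qed

section \<open>Gibbs and weak Gibbs bounds\<close>

text \<open>Logarithms make the constants additive, so that Gibbs bounds can be compared by linear
  arithmetic. Positivity of the measure is recorded separately: \<open>ln\<close> at 0 is a default
  value and would not reveal a null cylinder.\<close>

lemma gibbs_bounds_iff:
  assumes f: "log_sequence X f" and C: "\<And>n. n \<ge> 1 \<Longrightarrow> C n > 0"
  shows "gibbs_bounds X f \<mu> P C \<longleftrightarrow> (\<forall>x\<in>X. \<forall>n\<ge>1.
    0 < measure \<mu> (cylinder X (map x [0..<n])) \<and>
    \<bar>ln (measure \<mu> (cylinder X (map x [0..<n]))) + real n * P - ln (f n x)\<bar> < ln (C n))"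
  unfolding gibbs_bounds_def
proof (intro ball_cong refl all_cong)
  fix x n assume "x \<in> X" and "(1::nat) \<le> n"
  define m where "m = measure \<mu> (cylinder X (map x [0..<n]))"
  define a where "a = exp (- real n * P) * f n x"
  have "f n x > 0"
    using f \<open>x \<in> X\<close> \<open>1 \<le> n\<close> by (auto simp: log_sequence_def)
  then have a: "a > 0" "ln a = - real n * P + ln (f n x)"
    by (simp_all add: a_def ln_mult)
  have Cn: "C n > 0"
    using C[OF \<open>1 \<le> n\<close>] .
  have "1 / C n < m / a \<and> m / a < C n \<longleftrightarrow> 0 < m \<and> - ln (C n) < ln (m / a) \<and> ln (m / a) < ln (C n)"
  proof (cases "m > 0")
    case True
    then have "1 / C n < m / a \<longleftrightarrow> ln (1 / C n) < ln (m / a)" "m / a < C n \<longleftrightarrow> ln (m / a) < ln (C n)"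
      using a Cn by (simp_all del: ln_div)
    then show ?thesis
      using True Cn by (simp add: ln_div)
  next
    case False
    then have "m / a \<le> 0" "1 / C n > 0"
      using a Cn by (simp_all add: divide_le_0_iff)
    then show ?thesis
      using False by linarith
  qed
  moreover have "0 < m \<Longrightarrow> ln (m / a) = ln m + real n * P - ln (f n x)"
    using a by (simp add: ln_div)
  ultimately show "1 / C n < m / a \<and> m / a < C n \<longleftrightarrow> 0 < m \<and> \<bar>ln m + real n * P - ln (f n x)\<bar> < ln (C n)"
    by auto
qed

text \<open>The constant at length \<open>n\<close> is \<open>C * exp (e n)\<close> with
  \<open>e n\<close> the supremum distance of \<open>ln (f n x)\<close> from the Birkhoff sum. As
  \<open>e n\<close> is o(n) but possibly unbounded, the resulting bound is a weak one.\<close>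

lemma weak_gibbs_if_approximated:
  assumes X: "subshift X" "X \<noteq> {}" and f: "log_sequence X f"
    and m: "gibbs_measure X f m"
    and h: "continuous_on X h" and approx: "additively_approximated X f h"
  shows "weak_gibbs_measure X (\<lambda>n x. exp (birkhoff_sum n h x)) m"
proof -
  obtain P C where P: "pressure X f = ereal P" and "C > 0"
      and bounds: "gibbs_bounds X f m P (\<lambda>_. C)" and inv: "m \<in> invariant_measures X"
    using m by (auto simp: gibbs_measure_def)
  define e where "e n = (SUP x\<in>X. \<bar>ln (f n x) - birkhoff_sum n h x\<bar>)" for n
  have e: "\<bar>ln (f n x) - birkhoff_sum n h x\<bar> \<le> e n" if "n \<ge> 1" "x \<in> X" for n x
    unfolding e_def
    by (intro cSUP_upper that log_birkhoff_diff_bdd_above X f h)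
  have "(\<lambda>n. 1 / real n * e n) \<longlonglongrightarrow> 0"
  proof (rule tendstoI)
    fix \<epsilon> :: real assume "\<epsilon> > 0"
    then have "\<forall>\<^sub>F n in sequentially. 1 / real n * e n \<le> \<epsilon> / 2"
      unfolding e_def by (intro approximated_imp_SUP_le[OF approx X(2)]) simp
    then show "\<forall>\<^sub>F n in sequentially. dist (1 / real n * e n) 0 < \<epsilon>"
      using eventually_ge_at_top[of 1]
    proof eventually_elim
      case (elim n)
      obtain x where "x \<in> X"
        using X(2) by blast
      then have "0 \<le> 1 / real n * e n"
        using e[OF elim(2) \<open>x \<in> X\<close>] by (intro mult_nonneg_nonneg) auto
      then show ?case
        using elim(1) \<open>\<epsilon> > 0\<close> by (simp only: dist_real_def)
    qed
  qed
  then have "(\<lambda>n. ln C / real n + 1 / real n * e n) \<longlonglongrightarrow> 0 + 0"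
    by (intro tendsto_add lim_const_over_n)
  then have "(\<lambda>n. 1 / real n * ln (C * exp (e n))) \<longlonglongrightarrow> 0"
    using \<open>C > 0\<close> by (simp add: ln_mult add_divide_distrib)
  moreover have "gibbs_bounds X (\<lambda>n x. exp (birkhoff_sum n h x)) m P (\<lambda>n. C * exp (e n))"
  proof (subst gibbs_bounds_iff[OF log_sequence_exp_birkhoff[OF X(1) h]])
    show "\<forall>x\<in>X. \<forall>n\<ge>1. 0 < measure m (cylinder X (map x [0..<n])) \<and>
        \<bar>ln (measure m (cylinder X (map x [0..<n]))) + real n * P - ln (exp (birkhoff_sum n h x))\<bar>
          < ln (C * exp (e n))"
    proof (intro ballI allI impI)
      fix x n assume xn: "x \<in> X" "(1::nat) \<le> n"
      define c where "c = measure m (cylinder X (map x [0..<n]))"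
      have "0 < c" "\<bar>ln c + real n * P - ln (f n x)\<bar> < ln C"
        using bounds xn \<open>C > 0\<close> gibbs_bounds_iff[OF f, of "\<lambda>_. C" m P] by (auto simp: c_def)
      moreover have "ln (C * exp (e n)) = ln C + e n"
        using \<open>C > 0\<close> by (simp add: ln_mult)
      ultimately show "0 < c \<and> \<bar>ln c + real n * P - ln (exp (birkhoff_sum n h x))\<bar> < ln (C * exp (e n))"
        using e[OF xn(2,1)] unfolding ln_exp by linarith
    qed
  qed (use \<open>C > 0\<close> in simp)
  moreover have "pressure X (\<lambda>n x. exp (birkhoff_sum n h x)) = ereal P"
    using pressure_eq_if_approximated[OF X f h approx] P by simp
  ultimately show ?thesis
    using inv \<open>C > 0\<close> unfolding weak_gibbs_measure_def
    by (intro conjI exI[of _ P] exI[of _ "\<lambda>n. C * exp (e n)"]) auto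
qed

text \<open>Both bounds control the same cylinder measure, so its logarithm cancels. What remains is
  \<open>real n * (P - Q)\<close>, the Birkhoff sum of a constant, and the error
  \<open>ln C + ln (D n)\<close>, which is o(n).\<close>

lemma approximated_if_weak_gibbs:
  assumes X: "subshift X" and f: "log_sequence X f"
    and m: "gibbs_measure X f m"
    and h: "continuous_on X h" and weak: "weak_gibbs_measure X (\<lambda>n x. exp (birkhoff_sum n h x)) m"
  shows "\<exists>c. additively_approximated X f (\<lambda>x. h x + c)"
proof -
  obtain P C where "C > 0" and bounds: "gibbs_bounds X f m P (\<lambda>_. C)"
    using m by (auto simp: gibbs_measure_def)
  obtain Q D where D: "\<And>n. n \<ge> 1 \<Longrightarrow> D n > 0" "(\<lambda>n. 1 / real n * ln (D n)) \<longlonglongrightarrow> 0"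
      and bounds': "gibbs_bounds X (\<lambda>n x. exp (birkhoff_sum n h x)) m Q D"
    using weak by (auto simp: weak_gibbs_measure_def)
  have diff: "\<bar>ln (f n x) - birkhoff_sum n (\<lambda>x. h x + (P - Q)) x\<bar> \<le> ln C + ln (D n)"
    if xn: "x \<in> X" "n \<ge> 1" for x n
  proof -
    define c where "c = measure m (cylinder X (map x [0..<n]))"
    have "\<bar>ln c + real n * P - ln (f n x)\<bar> < ln C"
      using bounds xn \<open>C > 0\<close> gibbs_bounds_iff[OF f, of "\<lambda>_. C" m P] by (auto simp: c_def)
    moreover have "\<bar>ln c + real n * Q - birkhoff_sum n h x\<bar> < ln (D n)"
      using bounds' xn gibbs_bounds_iff[where \<mu> = m and P = Q, OF log_sequence_exp_birkhoff[OF X h] D(1)]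
      by (auto simp: c_def)
    moreover have "birkhoff_sum n (\<lambda>x. h x + (P - Q)) x = birkhoff_sum n h x + real n * P - real n * Q"
      by (simp add: birkhoff_sum_def sum.distrib right_diff_distrib)
    ultimately show ?thesis
      by linarith
  qed
  have "additively_approximated X f (\<lambda>x. h x + (P - Q))"
    unfolding additively_approximated_def
  proof (intro allI impI)
    fix \<epsilon> :: real assume "\<epsilon> > 0"
    have "(\<lambda>n. ln C / real n + 1 / real n * ln (D n)) \<longlonglongrightarrow> 0 + 0"
      by (intro tendsto_add lim_const_over_n D)
    then have "\<forall>\<^sub>F n in sequentially. ln C / real n + 1 / real n * ln (D n) < \<epsilon>"
      using \<open>\<epsilon> > 0\<close> by (auto dest: order_tendstoD)
    then show "\<forall>\<^sub>F n in sequentially. \<forall>x\<in>X.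
        \<bar>ln (f n x) - birkhoff_sum n (\<lambda>x. h x + (P - Q)) x\<bar> \<le> \<epsilon> * real n"
      using eventually_ge_at_top[of 1]
    proof eventually_elim
      case (elim n)
      then have "ln C + ln (D n) < \<epsilon> * real n"
        by (simp add: field_simps)
      then show ?case
        using diff[OF _ elim(2)] by fastforce
    qed
  qed
  then show ?thesis
    by blast
qed

theorem theorem5p1:
  fixes X :: "(nat \<Rightarrow> nat) set"
    and f :: "nat \<Rightarrow> (nat \<Rightarrow> nat) \<Rightarrow> real"
    and m :: "(nat \<Rightarrow> nat) measure"
  assumes "subshift X"
    and "log_sequence X f"
    and "bounded_variation_seq X f"
    and "condition_C1 X f"
    and "condition_C2 X f"
    and "gibbs_measure X f m"
  shows "((\<exists>h. continuous_on X h \<and>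
             (\<forall>x\<in>X. (\<lambda>n. 1 / real n * ln (f n x / exp (birkhoff_sum n h x))) \<longlonglongrightarrow> 0))
           \<longleftrightarrow> asymptotically_additive X f) \<and>
         (asymptotically_additive X f \<longleftrightarrow>
           (\<exists>h. continuous_on X h \<and> weak_gibbs_measure X (\<lambda>n x. exp (birkhoff_sum n h x)) m))"
proof -
  \<comment> \<open>The probability measure \<open>m\<close> lives on \<open>X\<close>, so
    \<open>X\<close> is nonempty, as is needed to pass from uniform bounds to suprema over
    \<open>X\<close>.\<close>
  have inv: "m \<in> invariant_measures X"
    using \<open>gibbs_measure X f m\<close> by (simp add: gibbs_measure_def)
  then have "space m = X"
    using sets_eq_imp_space_eq[of m "restrict_space borel X"]
    by (auto simp: invariant_measures_def space_restrict_space)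
  then have "X \<noteq> {}"
    using inv prob_space.not_empty by (auto simp: invariant_measures_def)
  have "(\<exists>h. continuous_on X h \<and>
        (\<forall>x\<in>X. (\<lambda>n. 1 / real n * ln (f n x / exp (birkhoff_sum n h x))) \<longlonglongrightarrow> 0))
      \<longleftrightarrow> (\<exists>h. continuous_on X h \<and> additively_approximated X f h)"
    using approximated_if_pointwise[OF assms(1-5)] pointwise_if_approximated[OF assms(2)] by blast
  moreover have "asymptotically_additive X f
      \<longleftrightarrow> (\<exists>h. continuous_on X h \<and> additively_approximated X f h)"
    using approximated_if_asymptotically_additive[OF assms(1,2)]
      asymptotically_additive_if_approximated \<open>X \<noteq> {}\<close> by blast
  moreover have "(\<exists>h. continuous_on X h \<and> weak_gibbs_measure X (\<lambda>n x. exp (birkhoff_sum n h x)) m)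
      \<longleftrightarrow> (\<exists>h. continuous_on X h \<and> additively_approximated X f h)"
  proof
    assume "\<exists>h. continuous_on X h \<and> weak_gibbs_measure X (\<lambda>n x. exp (birkhoff_sum n h x)) m"
    then obtain h c where "continuous_on X h" "additively_approximated X f (\<lambda>x. h x + c)"
      using approximated_if_weak_gibbs[OF assms(1,2,6)] by blast
    moreover from this have "continuous_on X (\<lambda>x. h x + c)"
      by (intro continuous_on_add continuous_on_const)
    ultimately show "\<exists>h. continuous_on X h \<and> additively_approximated X f h"
      by blast
  next
    assume "\<exists>h. continuous_on X h \<and> additively_approximated X f h"
    then show "\<exists>h. continuous_on X h \<and> weak_gibbs_measure X (\<lambda>n x. exp (birkhoff_sum n h x)) m"
      using weak_gibbs_if_approximated[OF assms(1) \<open>X \<noteq> {}\<close> assms(2,6)] by blast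
  qed
  ultimately show ?thesis
    by blast
qed

end
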